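(* For each $n$ let $P_n$ be the transition matrix of an irreducible, aperiodic, reversible Markov chain on a finite state space $X_n$, and let $x=x_n\in X_n$ be a starting state. Let $1=\beta_1>\beta_2\ge\dots\ge\beta_{|X_n|}>-1$ be the eigenvalues of $P_n$ and let $f_1,\dots,f_{|X_n|}:X_n\to\mathbb{R}$ be a corresponding eigenbasis that is orthonormal in $\ell^2(\pi_n)$, where $\pi_n$ is the stationary measure (the dependence of $\beta_i,f_i$ on $n$ is suppressed). Suppose that, in continuous time and started from $x$, the family exhibits total variation cutoff at $t_n$ with window $w_n$. Assume that there is a function $g:\mathbb{R}\to\mathbb{R}$ that is continuous (or bounded) such that for all $c\in\mathbb{R}$ $$\limsup_{n\to\infty}\; w_n^2\sum_{i=2}^{|X_n|} f_i(x)^2\,(1-\beta_i)^2\,e^{-2(t_n+cw_n)(1-\beta_i)}\le g(c).$$ Assume moreover that the total variation limit profile $\Phi_x(c)=\lim_{n\to\infty} d_x^{(n)}(t_n+cw_n)$ exists for all $c\in\mathbb{R}$. Then $\Phi_x:\mathbb{R}\to[0,1]$ is continuous.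
   Context: Continuous time walk: for a transition matrix $P=P_n$ on $X_n$ with stationary measure $\pi=\pi_n$, put $Q^t=e^{-t(I-P)}$ for $t\ge 0$, $Q_x^t(\cdot)=Q^t(x,\cdot)$, and $$d_x^{(n)}(t)=\|Q_x^t-\pi\|_{\mathrm{T.V.}}=\frac12\sum_{y\in X_n}|Q_x^t(y)-\pi(y)|.$$ The inner product of $\ell^2(\pi)$ is $\langle f,h\rangle_\pi=\sum_{y}\pi(y)f(y)h(y)$. Cutoff: $t_n>0$ and $w_n>0$ are real sequences with $w_n=o(t_n)$. The family has cutoff at $t_n$ with window $w_n$ (started from $x$) if $$\lim_{c\to\infty}\lim_{n\to\infty} d_x^{(n)}(t_n-cw_n)=1\quad\text{and}\quad \lim_{c\to\infty}\lim_{n\to\infty} d_x^{(n)}(t_n+cw_n)=0.$$ For each fixed $c\in\mathbb{R}$, $t_n+cw_n>0$ for all large $n$, so limits as $n\to\infty$ make sense. *)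

theory Defs
  imports "HOL-Analysis.Analysis" "HOL-Library.Landau_Symbols"
begin

text \<open>
  The state space of a chain is a finite set \<open>X\<close>, so that it may vary along a family;
  matrices indexed by \<open>X\<close> are functions of two arguments, of which only the values on
  \<open>X \<times> X\<close> matter. As \<open>X\<close> is finite, the series in \<open>kernel_exp\<close> converges on \<open>X \<times> X\<close>.
\<close>

type_synonym 'a kernel = "'a \<Rightarrow> 'a \<Rightarrow> real"

definition id_kernel :: "'a kernel" where
  "id_kernel x y = (if x = y then 1 else 0)"

primrec kernel_power :: "'a set \<Rightarrow> 'a kernel \<Rightarrow> nat \<Rightarrow> 'a kernel" where
  "kernel_power X A 0 = id_kernel"
| "kernel_power X A (Suc k) = (\<lambda>x y. \<Sum>z\<in>X. A x z * kernel_power X A k z y)"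

definition kernel_exp :: "'a set \<Rightarrow> 'a kernel \<Rightarrow> 'a kernel" where
  "kernel_exp X A x y = (\<Sum>k. kernel_power X A k x y / fact k)"

definition transition_matrix :: "'a set \<Rightarrow> 'a kernel \<Rightarrow> bool" where
  "transition_matrix X P \<longleftrightarrow>
     finite X \<and> X \<noteq> {} \<and> (\<forall>x\<in>X. \<forall>y\<in>X. 0 \<le> P x y) \<and> (\<forall>x\<in>X. (\<Sum>y\<in>X. P x y) = 1)"

definition irreducible_chain :: "'a set \<Rightarrow> 'a kernel \<Rightarrow> bool" where
  "irreducible_chain X P \<longleftrightarrow> (\<forall>x\<in>X. \<forall>y\<in>X. \<exists>k. kernel_power X P k x y > 0)"

definition aperiodic_chain :: "'a set \<Rightarrow> 'a kernel \<Rightarrow> bool" where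
  "aperiodic_chain X P \<longleftrightarrow> (\<forall>x\<in>X. Gcd {k. k \<ge> 1 \<and> kernel_power X P k x x > 0} = 1)"

definition stationary_measure :: "'a set \<Rightarrow> 'a kernel \<Rightarrow> ('a \<Rightarrow> real) \<Rightarrow> bool" where
  "stationary_measure X P \<pi> \<longleftrightarrow>
     (\<forall>x\<in>X. 0 \<le> \<pi> x) \<and> (\<Sum>x\<in>X. \<pi> x) = 1 \<and> (\<forall>y\<in>X. (\<Sum>x\<in>X. \<pi> x * P x y) = \<pi> y)"

definition reversible_chain :: "'a set \<Rightarrow> 'a kernel \<Rightarrow> ('a \<Rightarrow> real) \<Rightarrow> bool" where
  "reversible_chain X P \<pi> \<longleftrightarrow> (\<forall>x\<in>X. \<forall>y\<in>X. \<pi> x * P x y = \<pi> y * P y x)"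

definition l2_inner :: "'a set \<Rightarrow> ('a \<Rightarrow> real) \<Rightarrow> ('a \<Rightarrow> real) \<Rightarrow> ('a \<Rightarrow> real) \<Rightarrow> real" where
  "l2_inner X \<pi> f h = (\<Sum>y\<in>X. \<pi> y * f y * h y)"

text \<open>
  Eigenvalues and eigenfunctions are indexed by \<open>{1..card X}\<close>. The second eigenvalue
  exists only if \<open>X\<close> has at least two elements. Linear independence of the basis is a
  consequence of orthonormality.
\<close>

definition orthonormal_eigenbasis ::
  "'a set \<Rightarrow> 'a kernel \<Rightarrow> ('a \<Rightarrow> real) \<Rightarrow> (nat \<Rightarrow> real) \<Rightarrow> (nat \<Rightarrow> 'a \<Rightarrow> real) \<Rightarrow> bool" where
  "orthonormal_eigenbasis X P \<pi> \<beta> f \<longleftrightarrow>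
     \<beta> 1 = 1 \<and> (2 \<le> card X \<longrightarrow> \<beta> 2 < 1) \<and>
     (\<forall>i j. 1 \<le> i \<longrightarrow> i \<le> j \<longrightarrow> j \<le> card X \<longrightarrow> \<beta> j \<le> \<beta> i) \<and>
     \<beta> (card X) > -1 \<and>
     (\<forall>i\<in>{1..card X}. \<forall>x\<in>X. (\<Sum>y\<in>X. P x y * f i y) = \<beta> i * f i x) \<and>
     (\<forall>i\<in>{1..card X}. \<forall>j\<in>{1..card X}. l2_inner X \<pi> (f i) (f j) = (if i = j then 1 else 0)) \<and>
     (\<forall>h. \<exists>a. \<forall>x\<in>X. h x = (\<Sum>i=1..card X. a i * f i x))"

definition cont_kernel :: "'a set \<Rightarrow> 'a kernel \<Rightarrow> real \<Rightarrow> 'a kernel" where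
  "cont_kernel X P t = kernel_exp X (\<lambda>x y. - t * (id_kernel x y - P x y))"

definition tv_dist :: "'a set \<Rightarrow> ('a \<Rightarrow> real) \<Rightarrow> ('a \<Rightarrow> real) \<Rightarrow> real" where
  "tv_dist X \<mu> \<nu> = (1/2) * (\<Sum>y\<in>X. \<bar>\<mu> y - \<nu> y\<bar>)"

definition cont_tv :: "'a set \<Rightarrow> 'a kernel \<Rightarrow> ('a \<Rightarrow> real) \<Rightarrow> 'a \<Rightarrow> real \<Rightarrow> real" where
  "cont_tv X P \<pi> x t = tv_dist X (cont_kernel X P t x) \<pi>"

text \<open>
  In an iterated limit, the inner limit is required to exist for all large \<open>c\<close>. For fixed
  \<open>c\<close>, finitely many of the times \<open>t n - c * w n\<close> may be negative; this does not affect
  the limits in \<open>n\<close>.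
\<close>

definition cutoff :: "(nat \<Rightarrow> real \<Rightarrow> real) \<Rightarrow> (nat \<Rightarrow> real) \<Rightarrow> (nat \<Rightarrow> real) \<Rightarrow> bool" where
  "cutoff d t w \<longleftrightarrow>
     (\<forall>n. t n > 0) \<and> (\<forall>n. w n > 0) \<and> w \<in> o(t) \<and>
     (\<exists>L. (\<forall>\<^sub>F c in at_top. (\<lambda>n. d n (t n - c * w n)) \<longlonglongrightarrow> L c) \<and> (L \<longlongrightarrow> (1::real)) at_top) \<and>
     (\<exists>L. (\<forall>\<^sub>F c in at_top. (\<lambda>n. d n (t n + c * w n)) \<longlonglongrightarrow> L c) \<and> (L \<longlongrightarrow> (0::real)) at_top)"

end

theory Submission imports Defs begin

text \<open>
  Expanding in the eigenbasis, \<open>Q\<^sup>t(x,y) = \<pi>(y) (\<Sum>i. exp (- t (1 - \<beta>\<^sub>i)) f\<^sub>i(x) f\<^sub>i(y))\<close>. By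
  Cauchy--Schwarz in \<open>\<ell>\<^sup>2(\<pi>)\<close>, Parseval and \<open>exp (- s \<lambda>) - exp (- t \<lambda>) \<le> (t - s) \<lambda> exp (- s \<lambda>)\<close>,
  the total variation distances at times \<open>s \<le> t\<close> differ by at most \<open>(t - s) / 2\<close> times the square
  root of \<open>\<Sum>i. f\<^sub>i(x)\<^sup>2 (1 - \<beta>\<^sub>i)\<^sup>2 exp (- 2 s (1 - \<beta>\<^sub>i))\<close>. This sum is decreasing in \<open>s\<close>, so on each
  half-line \<open>[m, \<infinity>)\<close> the profile \<open>\<Phi>\<close> is Lipschitz with a constant controlled by \<open>g(m)\<close> alone.
\<close>

section \<open>Spectral expansion of matrix powers and exponentials\<close>

text \<open>Resolution of the identity: the point mass at \<open>y\<close> is expanded in the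
  eigenbasis, and orthonormality identifies its coefficients. It is the base case of all spectral
  expansions below.\<close>

lemma orthonormal_eigenbasis_resolution:
  assumes "orthonormal_eigenbasis X P \<pi> \<beta> f" "finite X" "x \<in> X" "y \<in> X"
  shows "id_kernel x y = (\<Sum>i=1..card X. f i x * f i y * \<pi> y)"
proof -
  have "\<exists>a. \<forall>z\<in>X. h z = (\<Sum>i=1..card X. a i * f i z)" for h
    using assms(1) unfolding orthonormal_eigenbasis_def by blast
  from this[of "\<lambda>z. id_kernel z y"]
  obtain a where a: "\<And>z. z \<in> X \<Longrightarrow> id_kernel z y = (\<Sum>i=1..card X. a i * f i z)"
    by blast
  have orth: "l2_inner X \<pi> (f i) (f j) = (if i = j then 1 else 0)"
    if "i \<in> {1..card X}" "j \<in> {1..card X}" for i j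
    using assms(1) that unfolding orthonormal_eigenbasis_def by blast
  have coeff: "a j = f j y * \<pi> y" if j: "j \<in> {1..card X}" for j
  proof -
    \<comment> \<open>The inner product of the point mass at \<open>y\<close> with
      \<open>f j\<close> is computed twice: directly, and through the expansion with coefficients
      \<open>a\<close>.\<close>
    have "\<pi> y * f j y = (\<Sum>z\<in>X. \<pi> z * id_kernel z y * f j z)"
      using assms by (subst sum.remove[of X y]) (auto simp: id_kernel_def intro!: sum.neutral)
    also have "\<dots> = (\<Sum>z\<in>X. \<Sum>i=1..card X. a i * (\<pi> z * f i z * f j z))"
      by (intro sum.cong refl) (simp add: a sum_distrib_left sum_distrib_right ac_simps)
    also have "\<dots> = (\<Sum>i=1..card X. a i * l2_inner X \<pi> (f i) (f j))"
      unfolding l2_inner_def by (subst sum.swap) (simp add: sum_distrib_left)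
    also have "\<dots> = (\<Sum>i=1..card X. if i = j then a i else 0)"
      by (intro sum.cong refl) (use orth j in auto)
    also have "\<dots> = a j"
      using j by simp
    finally show ?thesis by (simp add: mult.commute)
  qed
  show ?thesis
    using a[OF assms(3)] by (simp add: coeff ac_simps)
qed

text \<open>Each multiplication by \<open>A\<close> contributes one more factor
  \<open>\<mu> i\<close>. The kernel \<open>A\<close> is kept general because both the generator
  \<open>- s * (I - P)\<close> and \<open>s * P\<close> are treated; they share the eigenfunctions
  of \<open>P\<close>.\<close>

lemma kernel_power_spectral:
  assumes basis: "orthonormal_eigenbasis X P \<pi> \<beta> f" and X: "finite X" "x \<in> X" "y \<in> X"
    and eigen: "\<And>i z. i \<in> {1..card X} \<Longrightarrow> z \<in> X \<Longrightarrow> (\<Sum>u\<in>X. A z u * f i u) = \<mu> i * f i z"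
  shows "kernel_power X A k x y = (\<Sum>i=1..card X. \<mu> i ^ k * (f i x * f i y * \<pi> y))"
  using X(2)
proof (induction k arbitrary: x)
  case 0
  then show ?case
    using orthonormal_eigenbasis_resolution[OF basis X(1) _ X(3)] by simp
next
  case (Suc k)
  have "kernel_power X A (Suc k) x y
      = (\<Sum>z\<in>X. \<Sum>i=1..card X. \<mu> i ^ k * f i y * \<pi> y * (A x z * f i z))"
    by (simp add: Suc.IH sum_distrib_left ac_simps)
  also have "\<dots> = (\<Sum>i=1..card X. \<mu> i ^ k * f i y * \<pi> y * (\<Sum>z\<in>X. A x z * f i z))"
    by (subst sum.swap) (simp add: sum_distrib_left)
  also have "\<dots> = (\<Sum>i=1..card X. \<mu> i ^ Suc k * (f i x * f i y * \<pi> y))"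
    by (intro sum.cong refl) (simp add: eigen Suc.prems)
  finally show ?case .
qed

text \<open>Each eigenvalue contributes its own exponential series, and the finite sum over
  \<open>i\<close> commutes with the limit. The \<open>sums\<close> form is recorded as well,
  because the value of a \<open>suminf\<close> says nothing about convergence, on which the
  nonnegativity and row sum arguments rely.\<close>

lemma kernel_exp_spectral:
  assumes basis: "orthonormal_eigenbasis X P \<pi> \<beta> f" and X: "finite X" "x \<in> X" "y \<in> X"
    and eigen: "\<And>i z. i \<in> {1..card X} \<Longrightarrow> z \<in> X \<Longrightarrow> (\<Sum>u\<in>X. A z u * f i u) = \<mu> i * f i z"
  shows "(\<lambda>k. kernel_power X A k x y / fact k) sums (\<Sum>i=1..card X. exp (\<mu> i) * (f i x * f i y * \<pi> y))"
    and "kernel_exp X A x y = (\<Sum>i=1..card X. exp (\<mu> i) * (f i x * f i y * \<pi> y))"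
proof -
  have "(\<lambda>k. \<Sum>i=1..card X. \<mu> i ^ k / fact k * (f i x * f i y * \<pi> y))
      sums (\<Sum>i=1..card X. exp (\<mu> i) * (f i x * f i y * \<pi> y))"
    using exp_converges[where 'a = real]
    by (intro sums_sum sums_mult2) (simp add: field_simps)
  then show *: "(\<lambda>k. kernel_power X A k x y / fact k)
      sums (\<Sum>i=1..card X. exp (\<mu> i) * (f i x * f i y * \<pi> y))"
    by (subst kernel_power_spectral[OF basis X]) (simp_all add: eigen sum_divide_distrib)
  show "kernel_exp X A x y = (\<Sum>i=1..card X. exp (\<mu> i) * (f i x * f i y * \<pi> y))"
    unfolding kernel_exp_def by (rule sums_unique[OF *, symmetric])
qed

text \<open>Serves two choices of \<open>h\<close>: an eigenfunction, which yields the eigenvalue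
  \<open>- s * (1 - \<beta> i)\<close>, and the constant 1, which yields the zero row sums of the
  generator.\<close>

lemma sum_generator_apply:
  assumes "finite X" "z \<in> X"
  shows "(\<Sum>u\<in>X. - s * (id_kernel z u - P z u) * h u) = - s * (h z - (\<Sum>u\<in>X. P z u * h u))"
proof -
  have "(\<Sum>u\<in>X. id_kernel z u * h u) = h z"
    using assms
    by (subst sum.remove[of X z]) (auto simp: id_kernel_def intro!: sum.neutral split: if_splits)
  then have "(\<Sum>u\<in>X. (id_kernel z u - P z u) * h u) = h z - (\<Sum>u\<in>X. P z u * h u)"
    by (simp add: left_diff_distrib sum_subtractf)
  then show ?thesis
    by (simp only: sum_distrib_left[symmetric] mult.assoc)
qed

lemma orthonormal_eigenbasis_eigen:
  assumes "orthonormal_eigenbasis X P \<pi> \<beta> f" "i \<in> {1..card X}" "z \<in> X"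
  shows "(\<Sum>u\<in>X. P z u * f i u) = \<beta> i * f i z"
  using assms unfolding orthonormal_eigenbasis_def by blast

lemma cont_kernel_spectral:
  assumes basis: "orthonormal_eigenbasis X P \<pi> \<beta> f" and X: "finite X" "x \<in> X" "y \<in> X"
  shows "(\<lambda>k. kernel_power X (\<lambda>x y. - s * (id_kernel x y - P x y)) k x y / fact k)
      sums cont_kernel X P s x y"
    and "cont_kernel X P s x y
      = (\<Sum>i=1..card X. exp (- s * (1 - \<beta> i)) * (f i x * f i y * \<pi> y))"
proof -
  have eigen: "(\<Sum>u\<in>X. - s * (id_kernel z u - P z u) * f i u) = (- s * (1 - \<beta> i)) * f i z"
    if "i \<in> {1..card X}" "z \<in> X" for i z
    by (simp only: sum_generator_apply[OF X(1) that(2)] orthonormal_eigenbasis_eigen[OF basis that])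
      (simp add: algebra_simps)
  show "cont_kernel X P s x y
      = (\<Sum>i=1..card X. exp (- s * (1 - \<beta> i)) * (f i x * f i y * \<pi> y))"
    unfolding cont_kernel_def by (rule kernel_exp_spectral(2)[OF basis X]) (rule eigen)
  show "(\<lambda>k. kernel_power X (\<lambda>x y. - s * (id_kernel x y - P x y)) k x y / fact k)
      sums cont_kernel X P s x y"
    unfolding cont_kernel_def kernel_exp_def
    by (rule summable_sums, rule sums_summable, rule kernel_exp_spectral(1)[OF basis X])
      (rule eigen)
qed

section \<open>The continuous time kernel as a probability kernel\<close>

lemma kernel_power_nonneg:
  assumes "\<And>x y. x \<in> X \<Longrightarrow> y \<in> X \<Longrightarrow> 0 \<le> A x y" "x \<in> X" "y \<in> X"
  shows "0 \<le> kernel_power X A k x y"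
  using assms(2)
  by (induction k arbitrary: x) (auto simp: id_kernel_def assms(1,3) intro!: sum_nonneg mult_nonneg_nonneg)

text \<open>Nonnegativity comes from \<open>exp (- s (I - P)) = exp (- s) exp (s P)\<close>.\<close>

lemma cont_kernel_nonneg:
  assumes basis: "orthonormal_eigenbasis X P \<pi> \<beta> f" and tm: "transition_matrix X P"
    and X: "x \<in> X" "y \<in> X" and s: "0 \<le> s"
  shows "0 \<le> cont_kernel X P s x y"
proof -
  have fin: "finite X" and nonneg: "\<And>u v. u \<in> X \<Longrightarrow> v \<in> X \<Longrightarrow> 0 \<le> P u v"
    using tm unfolding transition_matrix_def by auto
  have eigen: "(\<Sum>u\<in>X. s * P z u * f i u) = (s * \<beta> i) * f i z"
    if "i \<in> {1..card X}" "z \<in> X" for i z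
    using orthonormal_eigenbasis_eigen[OF basis that]
    by (simp add: mult.assoc sum_distrib_left[symmetric])
  have "summable (\<lambda>k. kernel_power X (\<lambda>u v. s * P u v) k x y / fact k)"
    by (rule sums_summable, rule kernel_exp_spectral(1)[OF basis fin X]) (rule eigen)
  then have "0 \<le> (\<Sum>k. kernel_power X (\<lambda>u v. s * P u v) k x y / fact k)"
    by (rule suminf_nonneg) (use X s nonneg in \<open>auto intro!: divide_nonneg_nonneg kernel_power_nonneg\<close>)
  also have "\<dots> = (\<Sum>i=1..card X. exp (s * \<beta> i) * (f i x * f i y * \<pi> y))"
    unfolding kernel_exp_def[symmetric] by (rule kernel_exp_spectral(2)[OF basis fin X]) (rule eigen)
  finally have "0 \<le> exp (- s) * (\<Sum>i=1..card X. exp (s * \<beta> i) * (f i x * f i y * \<pi> y))"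
    by simp
  \<comment> \<open>The factorisation of the exponential is checked eigenvalue by eigenvalue, on the
    two spectral expansions.\<close>
  also have "\<dots> = cont_kernel X P s x y"
    unfolding cont_kernel_spectral(2)[OF basis fin X] sum_distrib_left
    by (intro sum.cong refl) (simp add: right_diff_distrib exp_diff exp_minus field_simps)
  finally show ?thesis .
qed

text \<open>The rows of the generator sum to zero, hence so do the rows of all its powers from the
  first on. Only the identity term of the exponential series contributes to the row sum.\<close>

lemma cont_kernel_row_sum:
  assumes basis: "orthonormal_eigenbasis X P \<pi> \<beta> f" and tm: "transition_matrix X P"
    and x: "x \<in> X"
  shows "(\<Sum>y\<in>X. cont_kernel X P s x y) = 1"
proof -
  let ?A = "\<lambda>x y. - s * (id_kernel x y - P x y)"
  have fin: "finite X" and rows: "\<And>u. u \<in> X \<Longrightarrow> (\<Sum>v\<in>X. P u v) = 1"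
    using tm unfolding transition_matrix_def by auto
  have A0: "(\<Sum>u\<in>X. ?A z u) = 0" if "z \<in> X" for z
    using sum_generator_apply[OF fin that, of s P "\<lambda>_. 1"] rows[OF that] by simp
  have pow: "(\<Sum>y\<in>X. kernel_power X ?A k z y) = (if k = 0 then 1 else 0)" if "z \<in> X" for k z
    using that
  proof (induction k arbitrary: z)
    case 0
    then show ?case using fin by (simp add: id_kernel_def)
  next
    case (Suc k)
    have "(\<Sum>y\<in>X. kernel_power X ?A (Suc k) z y)
        = (\<Sum>u\<in>X. ?A z u * (\<Sum>y\<in>X. kernel_power X ?A k u y))"
      unfolding kernel_power.simps by (subst sum.swap) (simp only: sum_distrib_left)
    also have "\<dots> = (\<Sum>u\<in>X. ?A z u * (if k = 0 then 1 else 0))"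
      by (intro sum.cong refl) (simp only: Suc.IH)
    also have "\<dots> = 0"
      using A0[OF Suc.prems] by (simp only: sum_distrib_right[symmetric] mult_zero_left)
    finally show ?case by simp
  qed
  have "(\<lambda>k. \<Sum>y\<in>X. kernel_power X ?A k x y / fact k) sums (\<Sum>y\<in>X. cont_kernel X P s x y)"
    by (intro sums_sum cont_kernel_spectral(1)[OF basis fin x])
  moreover have "(\<Sum>y\<in>X. kernel_power X ?A k x y / fact k) = (if k = 0 then 1 else 0)" for k
    using pow[OF x, of k] by (simp only: sum_divide_distrib[symmetric]) simp
  moreover have "(\<lambda>k::nat. if k = 0 then 1 else 0 :: real) sums 1"
    using sums_single[of 0 "\<lambda>_. 1 :: real"] by simp
  ultimately show ?thesis
    using sums_unique2 by fastforce
qed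

section \<open>Total variation estimates through \<ell>2(\<pi>)\<close>

lemma tv_dist_le_1:
  assumes "\<And>y. y \<in> X \<Longrightarrow> 0 \<le> \<mu> y" "(\<Sum>y\<in>X. \<mu> y) = 1"
    and "\<And>y. y \<in> X \<Longrightarrow> 0 \<le> \<nu> y" "(\<Sum>y\<in>X. \<nu> y) = 1"
  shows "tv_dist X \<mu> \<nu> \<le> 1"
proof -
  have "(\<Sum>y\<in>X. \<bar>\<mu> y - \<nu> y\<bar>) \<le> (\<Sum>y\<in>X. \<mu> y + \<nu> y)"
    by (intro sum_mono) (use assms in \<open>fastforce simp: abs_if\<close>)
  then show ?thesis
    unfolding tv_dist_def using assms by (simp add: sum.distrib)
qed

lemma tv_dist_nonneg: "0 \<le> tv_dist X \<mu> \<nu>"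
  unfolding tv_dist_def by (simp add: sum_nonneg)

lemma abs_tv_dist_diff_le:
  "\<bar>tv_dist X \<mu> \<nu> - tv_dist X \<mu>' \<nu>\<bar> \<le> 1/2 * (\<Sum>y\<in>X. \<bar>\<mu> y - \<mu>' y\<bar>)"
proof -
  have "\<bar>(\<Sum>y\<in>X. \<bar>\<mu> y - \<nu> y\<bar>) - (\<Sum>y\<in>X. \<bar>\<mu>' y - \<nu> y\<bar>)\<bar>
      \<le> (\<Sum>y\<in>X. \<bar>\<bar>\<mu> y - \<nu> y\<bar> - \<bar>\<mu>' y - \<nu> y\<bar>\<bar>)"
    unfolding sum_subtractf[symmetric] by (rule sum_abs)
  also have "\<dots> \<le> (\<Sum>y\<in>X. \<bar>\<mu> y - \<mu>' y\<bar>)"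
    by (intro sum_mono) linarith
  finally show ?thesis
    unfolding tv_dist_def by linarith
qed

text \<open>Parseval's identity, by expanding the square and applying orthonormality to each pair of
  indices. It is phrased in terms of coefficients, since these are what the kernel expansion
  supplies.\<close>

lemma parseval_eigenbasis:
  assumes "orthonormal_eigenbasis X P \<pi> \<beta> f"
  shows "(\<Sum>y\<in>X. \<pi> y * (\<Sum>i=1..card X. a i * f i y)\<^sup>2) = (\<Sum>i=1..card X. (a i)\<^sup>2)"
proof -
  have orth: "l2_inner X \<pi> (f i) (f j) = (if i = j then 1 else 0)"
    if "i \<in> {1..card X}" "j \<in> {1..card X}" for i j
    using assms that unfolding orthonormal_eigenbasis_def by blast
  have "(\<Sum>y\<in>X. \<pi> y * (\<Sum>i=1..card X. a i * f i y)\<^sup>2)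
      = (\<Sum>y\<in>X. \<Sum>i=1..card X. \<Sum>j=1..card X. a i * a j * (\<pi> y * f i y * f j y))"
    by (simp add: power2_eq_square sum_product sum_distrib_left ac_simps)
  also have "\<dots> = (\<Sum>i=1..card X. \<Sum>j=1..card X. a i * a j * l2_inner X \<pi> (f i) (f j))"
    unfolding l2_inner_def sum_distrib_left
    by (subst sum.swap, intro sum.cong refl, subst sum.swap, intro sum.cong refl)
  also have "\<dots> = (\<Sum>i=1..card X. \<Sum>j=1..card X. if j = i then a i * a j else 0)"
    by (intro sum.cong refl) (use orth in auto)
  also have "\<dots> = (\<Sum>i=1..card X. (a i)\<^sup>2)"
    by (intro sum.cong refl) (simp add: power2_eq_square)
  finally show ?thesis .
qed

text \<open>Cauchy-Schwarz with \<open>p y\<close> split as \<open>sqrt (p y) * sqrt (p y)\<close>;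
  one of the two factors sums to the total mass 1.\<close>

lemma sum_weighted_abs_le_sqrt:
  fixes p h :: "'a \<Rightarrow> real"
  assumes "\<And>y. y \<in> X \<Longrightarrow> 0 \<le> p y" "(\<Sum>y\<in>X. p y) = 1"
  shows "(\<Sum>y\<in>X. p y * \<bar>h y\<bar>) \<le> sqrt (\<Sum>y\<in>X. p y * (h y)\<^sup>2)"
proof -
  have "(\<Sum>y\<in>X. p y * \<bar>h y\<bar>)\<^sup>2 = (\<Sum>y\<in>X. sqrt (p y) * (sqrt (p y) * \<bar>h y\<bar>))\<^sup>2"
    by (rule arg_cong[where f = "\<lambda>x. x\<^sup>2"], rule sum.cong)
      (simp_all add: assms(1) mult.assoc[symmetric])
  also have "\<dots> \<le> (\<Sum>y\<in>X. (sqrt (p y))\<^sup>2) * (\<Sum>y\<in>X. (sqrt (p y) * \<bar>h y\<bar>)\<^sup>2)"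
    by (rule Cauchy_Schwarz_ineq_sum)
  also have "\<dots> = (\<Sum>y\<in>X. p y * (h y)\<^sup>2)"
    using assms by (simp add: power_mult_distrib)
  finally show ?thesis
    by (rule real_le_rsqrt)
qed

text \<open>Multiply \<open>1 - u \<le> exp (- u)\<close>, for \<open>u = (r - s) * l\<close>, by
  \<open>exp (- s * l)\<close>. Monotonicity of \<open>exp\<close> supplies the sign for the
  absolute value.\<close>

lemma exp_minus_diff_le:
  fixes l :: real
  assumes "0 \<le> l" "s \<le> r"
  shows "\<bar>exp (- r * l) - exp (- s * l)\<bar> \<le> (r - s) * (l * exp (- s * l))"
proof -
  have "1 - (r - s) * l \<le> exp (- ((r - s) * l))"
    using exp_ge_add_one_self[of "- ((r - s) * l)"] by simp
  then have "exp (- s * l) * (1 - (r - s) * l) \<le> exp (- s * l) * exp (- ((r - s) * l))"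
    by simp
  also have "\<dots> = exp (- r * l)"
    by (simp add: exp_add[symmetric] algebra_simps)
  finally have "exp (- s * l) - exp (- r * l) \<le> (r - s) * (l * exp (- s * l))"
    by (simp add: algebra_simps)
  moreover have "exp (- r * l) \<le> exp (- s * l)"
    using assms by (simp add: mult_right_mono)
  ultimately show ?thesis by linarith
qed

lemma orthonormal_eigenbasis_eigenvalue_le_1:
  assumes "orthonormal_eigenbasis X P \<pi> \<beta> f" "i \<in> {1..card X}"
  shows "\<beta> i \<le> 1"
  using assms unfolding orthonormal_eigenbasis_def by (metis atLeastAtMost_iff order_refl)

text \<open>Half the l1 norm of the difference of the kernels is at most half the \<ell>2(\<pi>)
  norm of its density, which Parseval evaluates. The times may have any sign, which covers the
  finitely many \<open>n\<close> with \<open>t n + a * w n\<close> negative.\<close>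

lemma cont_tv_diff_le:
  assumes basis: "orthonormal_eigenbasis X P \<pi> \<beta> f" and fin: "finite X" and x: "x \<in> X"
    and st: "stationary_measure X P \<pi>" and sr: "s \<le> r"
  shows "\<bar>cont_tv X P \<pi> x r - cont_tv X P \<pi> x s\<bar>
    \<le> (r - s) / 2 * sqrt (\<Sum>i=2..card X. (f i x)\<^sup>2 * (1 - \<beta> i)\<^sup>2 * exp (- 2 * s * (1 - \<beta> i)))"
    (is "_ \<le> _ * sqrt ?S")
proof -
  \<comment> \<open>These are the eigenbasis coefficients of the density, with respect to
    \<open>\<pi>\<close>, of the difference of the kernels at times \<open>r\<close> and
    \<open>s\<close>.\<close>
  define a where "a i = (exp (- r * (1 - \<beta> i)) - exp (- s * (1 - \<beta> i))) * f i x" for i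
  have pi: "\<And>y. y \<in> X \<Longrightarrow> 0 \<le> \<pi> y" "(\<Sum>y\<in>X. \<pi> y) = 1"
    using st unfolding stationary_measure_def by auto
  have \<beta>1: "\<beta> 1 = 1"
    using basis unfolding orthonormal_eigenbasis_def by blast
  have diff: "\<bar>cont_kernel X P r x y - cont_kernel X P s x y\<bar>
      = \<pi> y * \<bar>\<Sum>i=1..card X. a i * f i y\<bar>" if "y \<in> X" for y
  proof -
    have "cont_kernel X P r x y - cont_kernel X P s x y = \<pi> y * (\<Sum>i=1..card X. a i * f i y)"
      unfolding cont_kernel_spectral(2)[OF basis fin x that] sum_subtractf[symmetric] sum_distrib_left
        a_def
      by (intro sum.cong refl) (simp add: algebra_simps)
    then show ?thesis
      using pi(1)[OF that] by (simp add: abs_mult)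
  qed
  have "(a i)\<^sup>2 \<le> (r - s)\<^sup>2 * ((f i x)\<^sup>2 * (1 - \<beta> i)\<^sup>2 * exp (- 2 * s * (1 - \<beta> i)))"
    if "i \<in> {1..card X}" for i
  proof -
    have "\<bar>exp (- r * (1 - \<beta> i)) - exp (- s * (1 - \<beta> i))\<bar>
        \<le> (r - s) * ((1 - \<beta> i) * exp (- s * (1 - \<beta> i)))"
      by (rule exp_minus_diff_le)
        (use orthonormal_eigenbasis_eigenvalue_le_1[OF basis that] sr in auto)
    then have "\<bar>exp (- r * (1 - \<beta> i)) - exp (- s * (1 - \<beta> i))\<bar>\<^sup>2
        \<le> ((r - s) * ((1 - \<beta> i) * exp (- s * (1 - \<beta> i))))\<^sup>2"
      by (rule power_mono) simp
    then have "(exp (- r * (1 - \<beta> i)) - exp (- s * (1 - \<beta> i)))\<^sup>2 * (f i x)\<^sup>2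
        \<le> ((r - s) * ((1 - \<beta> i) * exp (- s * (1 - \<beta> i))))\<^sup>2 * (f i x)\<^sup>2"
      unfolding power2_abs by (rule mult_right_mono) simp
    also have "\<dots> = (r - s)\<^sup>2 * ((f i x)\<^sup>2 * (1 - \<beta> i)\<^sup>2 * (exp (- s * (1 - \<beta> i)))\<^sup>2)"
      by (simp only: power_mult_distrib ac_simps)
    also have "(exp (- s * (1 - \<beta> i)))\<^sup>2 = exp (- 2 * s * (1 - \<beta> i))"
      by (simp add: exp_double[symmetric] algebra_simps)
    finally show ?thesis
      by (simp only: a_def power_mult_distrib)
  qed
  note term_bound = this
  \<comment> \<open>The coefficient at index 1 vanishes because \<open>\<beta> 1 = 1\<close>: the
    stationary part does not change with time.\<close>
  have "(\<Sum>i=1..card X. (a i)\<^sup>2) = (\<Sum>i=2..card X. (a i)\<^sup>2)"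
    by (rule sum.mono_neutral_right) (auto simp: a_def \<beta>1[unfolded One_nat_def] not_le less_Suc_eq numeral_2_eq_2)
  also have "\<dots> \<le> (r - s)\<^sup>2 * ?S"
    unfolding sum_distrib_left by (intro sum_mono term_bound) auto
  finally have parseval: "(\<Sum>i=1..card X. (a i)\<^sup>2) \<le> (r - s)\<^sup>2 * ?S" .
  have "(\<Sum>y\<in>X. \<bar>cont_kernel X P r x y - cont_kernel X P s x y\<bar>)
      = (\<Sum>y\<in>X. \<pi> y * \<bar>\<Sum>i=1..card X. a i * f i y\<bar>)"
    by (intro sum.cong refl diff)
  also have "\<dots> \<le> sqrt (\<Sum>y\<in>X. \<pi> y * (\<Sum>i=1..card X. a i * f i y)\<^sup>2)"
    by (rule sum_weighted_abs_le_sqrt[OF pi])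
  also have "\<dots> \<le> sqrt ((r - s)\<^sup>2 * ?S)"
    unfolding parseval_eigenbasis[OF basis] using parseval by (rule real_sqrt_le_mono)
  also have "\<dots> = (r - s) * sqrt ?S"
    using sr by (simp add: real_sqrt_mult)
  finally show ?thesis
    using abs_tv_dist_diff_le[of X "cont_kernel X P r x" \<pi> "cont_kernel X P s x"]
    unfolding cont_tv_def by linarith
qed

section \<open>Passage to the limit along the family\<close>

theorem theorem3:
  fixes X :: "nat \<Rightarrow> 'a set" and P :: "nat \<Rightarrow> 'a \<Rightarrow> 'a \<Rightarrow> real"
    and \<pi> :: "nat \<Rightarrow> 'a \<Rightarrow> real" and x :: "nat \<Rightarrow> 'a"
    and \<beta> :: "nat \<Rightarrow> nat \<Rightarrow> real" and f :: "nat \<Rightarrow> nat \<Rightarrow> 'a \<Rightarrow> real"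
    and t w :: "nat \<Rightarrow> real" and g \<Phi> :: "real \<Rightarrow> real"
  assumes "\<And>n. transition_matrix (X n) (P n)"
    and "\<And>n. irreducible_chain (X n) (P n)"
    and "\<And>n. aperiodic_chain (X n) (P n)"
    and "\<And>n. stationary_measure (X n) (P n) (\<pi> n)"
    and "\<And>n. reversible_chain (X n) (P n) (\<pi> n)"
    and "\<And>n. x n \<in> X n"
    and "\<And>n. orthonormal_eigenbasis (X n) (P n) (\<pi> n) (\<beta> n) (f n)"
    and "cutoff (\<lambda>n. cont_tv (X n) (P n) (\<pi> n) (x n)) t w"
    and "continuous_on UNIV g \<or> bounded (range g)"
    and "\<And>c. limsup (\<lambda>n. ereal ((w n)\<^sup>2 * (\<Sum>i=2..card (X n).
            (f n i (x n))\<^sup>2 * (1 - \<beta> n i)\<^sup>2 * exp (- 2 * (t n + c * w n) * (1 - \<beta> n i)))))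
          \<le> ereal (g c)"
    and "\<And>c. (\<lambda>n. cont_tv (X n) (P n) (\<pi> n) (x n) (t n + c * w n)) \<longlonglongrightarrow> \<Phi> c"
  shows "(\<forall>c. \<Phi> c \<in> {0..1}) \<and> continuous_on UNIV \<Phi>"
proof -
  let ?d = "\<lambda>c n. cont_tv (X n) (P n) (\<pi> n) (x n) (t n + c * w n)"
  let ?S = "\<lambda>c n. \<Sum>i=2..card (X n). (f n i (x n))\<^sup>2 * (1 - \<beta> n i)\<^sup>2
      * exp (- 2 * (t n + c * w n) * (1 - \<beta> n i))"
  have fin: "finite (X n)" for n
    using assms(1) unfolding transition_matrix_def by blast
  have pi: "\<And>y. y \<in> X n \<Longrightarrow> 0 \<le> \<pi> n y" "(\<Sum>y\<in>X n. \<pi> n y) = 1" for n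
    using assms(4) unfolding stationary_measure_def by auto
  have tpos: "t n > 0" and wpos: "w n > 0" and small: "w \<in> o(t)" for n
    using assms(8) unfolding cutoff_def by auto

  have "\<Phi> c \<in> {0..1}" for c
  proof -
    \<comment> \<open>As \<open>w\<close> is of smaller order than \<open>t\<close>, the time
      \<open>t n + c * w n\<close> is eventually nonnegative, so that the kernel is a probability
      there. Adding 1 to \<open>\<bar>c\<bar>\<close> keeps the constant positive when
      \<open>c = 0\<close>.\<close>
    have "eventually (\<lambda>n. norm (w n) \<le> 1 / (\<bar>c\<bar> + 1) * norm (t n)) sequentially"
      by (rule landau_o.smallD[OF small]) simp
    then have "eventually (\<lambda>n. ?d c n \<le> 1) sequentially"
    proof eventually_elim
      case (elim n)
      have "\<bar>c\<bar> * w n \<le> (\<bar>c\<bar> + 1) * w n"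
        using wpos[of n] by (simp add: mult_right_mono)
      also have "\<dots> \<le> t n"
        using elim wpos[of n] tpos[of n] by (simp add: field_simps)
      finally have "0 \<le> t n + c * w n"
        using abs_ge_minus_self[of "c * w n"] wpos[of n] by (simp add: abs_mult)
      then show ?case
        unfolding cont_tv_def using pi
        by (intro tv_dist_le_1 cont_kernel_nonneg[OF assms(7) assms(1) assms(6)]
            cont_kernel_row_sum[OF assms(7) assms(1) assms(6)])
    qed
    then have "\<Phi> c \<le> 1"
      by (rule tendsto_upperbound[OF assms(11)]) simp
    moreover have "0 \<le> \<Phi> c"
      by (rule tendsto_lowerbound[OF assms(11)]) (simp_all add: cont_tv_def tv_dist_nonneg)
    ultimately show ?thesis by simp
  qed
  moreover have "continuous_on UNIV \<Phi>"
  proof -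
    \<comment> \<open>The limsup bound is evaluated at the single point \<open>m\<close>, which
      gives one constant for the whole half-line to its right. The added 1 makes the bound strict,
      so that it holds for all large \<open>n\<close>.\<close>
    have lip: "\<bar>\<Phi> b - \<Phi> a\<bar> \<le> sqrt (g m + 1) / 2 * (b - a)" if "m \<le> a" "a \<le> b" for m a b
    proof -
      have "limsup (\<lambda>n. ereal ((w n)\<^sup>2 * ?S m n)) < ereal (g m + 1)"
        by (rule le_less_trans[OF assms(10)]) simp
      then have "eventually (\<lambda>n. (w n)\<^sup>2 * ?S m n < g m + 1) sequentially"
        using Limsup_lessD by fastforce
      then have "eventually (\<lambda>n. \<bar>?d b n - ?d a n\<bar> \<le> sqrt (g m + 1) / 2 * (b - a)) sequentially"
      proof eventually_elim
        case (elim n)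
        \<comment> \<open>Every exponent decreases in time, as \<open>1 - \<beta> n i\<close> is
          nonnegative and \<open>a\<close> lies to the right of \<open>m\<close>.\<close>
        have "?S a n \<le> ?S m n"
        proof (intro sum_mono mult_left_mono)
          fix i assume "i \<in> {2..card (X n)}"
          then have "0 \<le> 1 - \<beta> n i"
            using orthonormal_eigenbasis_eigenvalue_le_1[OF assms(7)] by simp
          moreover have "- 2 * (t n + a * w n) \<le> - 2 * (t n + m * w n)"
            using that(1) wpos[of n] by (simp add: mult_right_mono)
          ultimately show "exp (- 2 * (t n + a * w n) * (1 - \<beta> n i))
              \<le> exp (- 2 * (t n + m * w n) * (1 - \<beta> n i))"
            by (metis exp_le_cancel_iff mult_right_mono)
        qed simp
        then have "(w n)\<^sup>2 * ?S a n \<le> (w n)\<^sup>2 * ?S m n"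
          by (rule mult_left_mono) simp
        with elim have "sqrt ((w n)\<^sup>2 * ?S a n) \<le> sqrt (g m + 1)"
          by (intro real_sqrt_le_mono) linarith
        then have S: "w n * sqrt (?S a n) \<le> sqrt (g m + 1)"
          using wpos[of n] by (simp add: real_sqrt_mult)
        have "\<bar>?d b n - ?d a n\<bar> \<le> ((t n + b * w n) - (t n + a * w n)) / 2 * sqrt (?S a n)"
          using that(2) wpos[of n]
          by (intro cont_tv_diff_le[OF assms(7) fin assms(6) assms(4)]) (simp add: mult_right_mono)
        \<comment> \<open>The time difference is \<open>(b - a) * w n\<close>; its factor
          \<open>w n\<close> is matched by the factor \<open>(w n)\<^sup>2\<close> in the limsup
          hypothesis.\<close>
        also have "\<dots> = (b - a) / 2 * (w n * sqrt (?S a n))"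
          by (simp add: algebra_simps)
        also have "\<dots> \<le> (b - a) / 2 * sqrt (g m + 1)"
          using S that(2) by (intro mult_left_mono) auto
        finally show ?case by (simp add: algebra_simps)
      qed
      moreover have "(\<lambda>n. \<bar>?d b n - ?d a n\<bar>) \<longlonglongrightarrow> \<bar>\<Phi> b - \<Phi> a\<bar>"
        by (intro tendsto_intros assms(11))
      ultimately show ?thesis
        using tendsto_upperbound trivial_limit_sequentially by blast
    qed
    have "isCont \<Phi> c" for c
    proof -
      \<comment> \<open>A Lipschitz constant must be nonnegative, whereas \<open>sqrt\<close> of a
        negative real is negative in HOL. The sign is read off from \<open>lip\<close> on the
        interval from \<open>c\<close> to \<open>c + 1\<close>.\<close>
      have "0 \<le> sqrt (g (c - 1) + 1) / 2 * (c + 1 - c)"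
        by (rule order_trans[OF abs_ge_zero lip]) simp_all
      then have "(sqrt (g (c - 1) + 1) / 2)-lipschitz_on {c - 1..} \<Phi>"
      proof (intro lipschitz_on_leI)
        fix a b assume "a \<in> {c - 1..}" "a \<le> b"
        then show "dist (\<Phi> a) (\<Phi> b) \<le> sqrt (g (c - 1) + 1) / 2 * dist a b"
          using lip[of "c - 1" a b] by (simp add: dist_real_def abs_minus_commute)
      qed simp
      \<comment> \<open>Starting at \<open>c - 1\<close> makes \<open>c\<close> an interior point;
        on the open half-line continuity is continuity at each point.\<close>
      then have "continuous_on {c - 1<..} \<Phi>"
        by (rule continuous_on_subset[OF lipschitz_on_continuous_on]) auto
      then show ?thesis
        by (simp add: continuous_on_eq_continuous_at)
    qed
    then show ?thesis
      by (simp add: continuous_on_eq_continuous_at)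
  qed
  ultimately show ?thesis by blast
qed

end
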